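(* For any realization of $r$, the informed investor's unique equilibrium disclosure and trading decisions are characterized by three regions: 1. For $x\in(-\infty,\underline{x})$, the investor takes a short position and discloses $x$. 2. For $x\in(\bar{x},+\infty)$, the investor takes a long position and discloses $x$. 3. For $x\in[\underline{x},\bar{x}]$, the investor withholds $x$ and takes a short (long) position when $r<r_0$ ($r>r_0$). The partially informed investor takes a short (long) position when $r<r_0$ ($r>r_0$). When $r<r_0$, $\bar{x}$ and $\underline{x}$ are uniquely determined by $$\beta\int_{\underline{x}}^{\bar{x}}\bigl(G(x)-G(\bar{x})\bigr)dx-(1-\beta)(\mu_0-\underline{x})=0,\qquad (1+q)\bar{x}+(1-q)\underline{x}=\frac{2r_0\mu_0}{r}.$$ When $r>r_0$, $\bar{x}$ and $\underline{x}$ are uniquely determined by $$\beta\int_{\underline{x}}^{\bar{x}}\bigl(G(x)-G(\underline{x})\bigr)dx-(1-\beta)(\mu_0-\bar{x})=0,\qquad (1-q)\bar{x}+(1+q)\underline{x}=\frac{2r_0\mu_0}{r}.$$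
   Context: A firm has value $\theta=rx$, where $r$ and $x$ are independent. $r$ is a continuous variable on $\mathbb{R}^+$ with mean $r_0$; $x$ is a continuous variable on $\mathbb{R}$ with density $g$, cdf $G$ and mean $\mu_0>0$. An investor who has learned $r$ always discloses it in equilibrium. Conditional on having learned $r$, the investor also learns $x$ with probability $\beta$ ( *informed* ) and otherwise knows only $r$ ( *partially informed* ). Before disclosure the investor takes a position $\rho\in[-1,1]$ ($\rho<0$ short, $\rho>0$ long) at price $P_1=E[\theta]=r_0\mu_0$. Then the informed investor either truthfully discloses $x$ along with $r$, or withholds $x$; the partially informed investor cannot disclose $x$. After the disclosure decision, $\theta$ is revealed by other sources with probability $q$. The position is then closed at price $P_2$: $P_2=rx$ if $x$ was disclosed or $\theta$ revealed; otherwise $P_2=r\mu_{ND}$, where $\mu_{ND}$ is the market's posterior expectation of $x$ upon observing only $r$. The investor chooses position and disclosure to maximize $E[\rho(P_2-P_1)]$ given their information; the informed investor withholds $x$ if and only if $|qrx+(1-q)r\mu_{ND}-r_0\mu_0|\ge|rx-r_0\mu_0|$. In equilibrium decisions are optimal given $\mu_{ND}$, and $\mu_{ND}$ follows from Bayes' rule: if $W$ is the set of values of $x$ withheld by the informed investor (for the given $r$), $$\mu_{ND}=\frac{(1-\beta)\mu_0+\beta\int_{W}x\,g(x)dx}{1-\beta+\beta\int_{W}g(x)dx}.$$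
   Formalization: Assumes β<1 and q<1 (claim fails or Bayes' rule is 0/0 at 1); the full equilibrium is unique only for r≠r0 (investors can be indifferent at r=r0); the thresholds are unique among solutions with x̲≤x̄, since unordered extra solutions can exist. *)

theory Defs
  imports "HOL-Probability.Probability"
begin

text \<open>
  Everything below is conditional on a realization \<open>r\<close>, which the investor discloses and the
  market therefore observes; \<open>m\<close> stands for the market's expectation of \<open>x\<close> when only \<open>r\<close> has been
  disclosed and \<open>P1\<close> for the opening price.
\<close>

definition closing_price :: "real \<Rightarrow> real \<Rightarrow> bool \<Rightarrow> bool \<Rightarrow> real \<Rightarrow> real" where
  "closing_price r m disclosed revealed x = (if disclosed \<or> revealed then r * x else r * m)"

definition informed_profit ::
    "real \<Rightarrow> real \<Rightarrow> real \<Rightarrow> real \<Rightarrow> real \<Rightarrow> bool \<Rightarrow> real \<Rightarrow> real" where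
  "informed_profit q P1 r m \<rho> disclosed x =
     measure_pmf.expectation (bernoulli_pmf q)
       (\<lambda>revealed. \<rho> * (closing_price r m disclosed revealed x - P1))"

text \<open>
  Knowing \<open>r\<close> does not change the distribution of \<open>X\<close>, which is independent of \<open>r\<close>, so the
  partially informed investor averages over the prior distribution of \<open>X\<close>.
\<close>

definition partial_profit ::
    "'w measure \<Rightarrow> ('w \<Rightarrow> real) \<Rightarrow> real \<Rightarrow> real \<Rightarrow> real \<Rightarrow> real \<Rightarrow> real \<Rightarrow> real" where
  "partial_profit M X q P1 r m \<rho> =
     prob_space.expectation M (\<lambda>w. informed_profit q P1 r m \<rho> False (X w))"

definition bayes_belief :: "real \<Rightarrow> (real \<Rightarrow> real) \<Rightarrow> real \<Rightarrow> real set \<Rightarrow> real" where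
  "bayes_belief \<beta> g \<mu>0 W =
     ((1 - \<beta>) * \<mu>0 + \<beta> * (LINT x:W|lborel. x * g x)) / (1 - \<beta> + \<beta> * (LINT x:W|lborel. g x))"

record profile =
  informed_position :: "real \<Rightarrow> real"
  withheld :: "real set"
  partial_position :: real
  belief :: real

text \<open>
  Given the optimality clause, the explicit description of the withheld set only settles ties:
  an informed investor who is indifferent withholds.
\<close>

definition is_equilibrium ::
    "'w measure \<Rightarrow> ('w \<Rightarrow> real) \<Rightarrow> (real \<Rightarrow> real) \<Rightarrow> real \<Rightarrow> real \<Rightarrow> real \<Rightarrow> real \<Rightarrow> real \<Rightarrow> profile \<Rightarrow> bool"
  where
  "is_equilibrium M X g \<beta> q \<mu>0 P1 r s \<longleftrightarrow>
     (\<forall>x. informed_position s x \<in> {-1..1} \<and>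
          (\<forall>\<rho>\<in>{-1..1}. \<forall>disclosed.
             informed_profit q P1 r (belief s) \<rho> disclosed x
             \<le> informed_profit q P1 r (belief s) (informed_position s x) (x \<notin> withheld s) x)) \<and>
     withheld s = {x. \<bar>q * r * x + (1 - q) * r * belief s - P1\<bar> \<ge> \<bar>r * x - P1\<bar>} \<and>
     partial_position s \<in> {-1..1} \<and>
     (\<forall>\<rho>\<in>{-1..1}. partial_profit M X q P1 r (belief s) \<rho>
                    \<le> partial_profit M X q P1 r (belief s) (partial_position s)) \<and>
     belief s = bayes_belief \<beta> g \<mu>0 (withheld s)"

text \<open>
  The thresholds bound an interval, so \<open>xl \<le> xu\<close> is part of both systems. Without it the two
  equations can have further solutions with \<open>xu < xl\<close>, for instance when \<open>\<beta> > 1/2\<close>.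
\<close>

definition thresholds_low ::
    "(real \<Rightarrow> real) \<Rightarrow> real \<Rightarrow> real \<Rightarrow> real \<Rightarrow> real \<Rightarrow> real \<Rightarrow> real \<Rightarrow> real \<Rightarrow> bool" where
  "thresholds_low G \<beta> q \<mu>0 r0 r xl xu \<longleftrightarrow>
     xl \<le> xu \<and>
     \<beta> * (LBINT x=xl..xu. G x - G xu) - (1 - \<beta>) * (\<mu>0 - xl) = 0 \<and>
     (1 + q) * xu + (1 - q) * xl = 2 * r0 * \<mu>0 / r"

definition thresholds_high ::
    "(real \<Rightarrow> real) \<Rightarrow> real \<Rightarrow> real \<Rightarrow> real \<Rightarrow> real \<Rightarrow> real \<Rightarrow> real \<Rightarrow> real \<Rightarrow> bool" where
  "thresholds_high G \<beta> q \<mu>0 r0 r xl xu \<longleftrightarrow>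
     xl \<le> xu \<and>
     \<beta> * (LBINT x=xl..xu. G x - G xl) - (1 - \<beta>) * (\<mu>0 - xu) = 0 \<and>
     (1 - q) * xu + (1 + q) * xl = 2 * r0 * \<mu>0 / r"

end

theory Submission
  imports Defs
begin

text \<open>
  Everything is governed by the market's belief \<open>m\<close>. With \<open>c = P1 / r\<close>, factoring the difference of
  squares in the withholding rule shows that the investor withholds exactly between \<open>m\<close> and the point
  \<open>b\<close> with \<open>(1 + q) * b + (1 - q) * m = 2 * c\<close>. If \<open>F\<close> is an antiderivative of the cdf \<open>G\<close>, Bayes' rule
  for this interval becomes an equation in \<open>m\<close> involving only the Bregman divergence
  \<open>F m - F b - (m - b) * G b\<close> of the convex function \<open>F\<close>; convexity makes its left-hand side strictly
  decreasing in \<open>m\<close>, with a sign change between \<open>\<mu>0\<close> and \<open>c\<close>. Hence the belief is unique and lies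
  below \<open>c\<close> iff \<open>r < r0\<close>, in which case \<open>m\<close> is the lower threshold, and above \<open>c\<close> iff \<open>r0 < r\<close>, in
  which case it is the upper one.
\<close>

section \<open>The withheld interval and its Bregman divergence\<close>

text \<open>Affine reflection about \<open>c\<close>, scaled by \<open>(1 - q) / (1 + q)\<close>:
  for 0 \<le> q < 1 the image of \<open>m\<close> lies on the other side of \<open>c\<close> and no
  farther from it.\<close>

definition mirror_point :: "real \<Rightarrow> real \<Rightarrow> real \<Rightarrow> real" where
  "mirror_point q c m = (2 * c - (1 - q) * m) / (1 + q)"

definition withheld_interval :: "real \<Rightarrow> real \<Rightarrow> real \<Rightarrow> real set" where
  "withheld_interval q c m = {min m (mirror_point q c m)..max m (mirror_point q c m)}"

text \<open>For \<open>F' = G\<close> this is the oriented integral of \<open>G x - G b\<close> from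
  \<open>b\<close> to \<open>a\<close>, up to sign the integral in both threshold equations.\<close>

definition bregman :: "(real \<Rightarrow> real) \<Rightarrow> (real \<Rightarrow> real) \<Rightarrow> real \<Rightarrow> real \<Rightarrow> real" where
  "bregman F G a b = F a - F b - (a - b) * G b"

text \<open>
  Bayes' rule for the belief \<open>m\<close>, cleared of its denominator, is \<open>excess F G \<beta> q \<mu> c m = 0\<close>. The
  Bregman term switches sign at \<open>c\<close> because there \<open>m\<close> turns from the left into the right end of the withheld interval.
\<close>

definition excess ::
    "(real \<Rightarrow> real) \<Rightarrow> (real \<Rightarrow> real) \<Rightarrow> real \<Rightarrow> real \<Rightarrow> real \<Rightarrow> real \<Rightarrow> real \<Rightarrow> real" where
  "excess F G \<beta> q \<mu> c m =
     (1 - \<beta>) * (\<mu> - m) + (if m \<le> c then \<beta> else - \<beta>) * bregman F G m (mirror_point q c m)"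

lemma mirror_eq_iff:
  assumes "0 \<le> q"
  shows "b = mirror_point q c m \<longleftrightarrow> (1 + q) * b + (1 - q) * m = 2 * c"
  using assms by (auto simp: mirror_point_def field_simps)

lemma mirror_antimono:
  assumes "0 \<le> q" "q < 1" "m \<le> m'"
  shows "mirror_point q c m' \<le> mirror_point q c m"
  using assms by (auto simp: mirror_point_def intro!: divide_right_mono mult_left_mono)

lemma mirror_fixpoint: "0 \<le> q \<Longrightarrow> mirror_point q c c = c"
  by (simp add: mirror_point_def field_simps)

lemma mirror_ge: "0 \<le> q \<Longrightarrow> q < 1 \<Longrightarrow> m \<le> c \<Longrightarrow> c \<le> mirror_point q c m"
  using mirror_antimono[of q m c c] by (simp add: mirror_fixpoint)

lemma mirror_le: "0 \<le> q \<Longrightarrow> q < 1 \<Longrightarrow> c \<le> m \<Longrightarrow> mirror_point q c m \<le> c"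
  using mirror_antimono[of q c m c] by (simp add: mirror_fixpoint)

lemma withhold_iff_between:
  assumes "0 \<le> q" "q < 1" "0 < r"
  shows "\<bar>r * x - P\<bar> \<le> \<bar>q * r * x + (1 - q) * r * m - P\<bar> \<longleftrightarrow>
    x \<in> withheld_interval q (P / r) m"
proof -
  define b where "b = mirror_point q (P / r) m"
  have "(1 + q) * b + (1 - q) * m = 2 * (P / r)"
    using mirror_eq_iff[OF assms(1)] b_def by blast
  then have P: "P = r * ((1 + q) * b + (1 - q) * m) / 2"
    using assms by (simp add: field_simps)
  \<comment> \<open>The difference of the two squared quantities is
    \<open>(1 - q) * r * (m - x)\<close>, their sum is \<open>(1 + q) * r * (x - b)\<close>.\<close>
  have "(q * r * x + (1 - q) * r * m - P)\<^sup>2 - (r * x - P)\<^sup>2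
      = (r\<^sup>2 * (1 - q) * (1 + q)) * ((m - x) * (x - b))"
    unfolding P by (simp add: field_simps power2_eq_square)
  moreover have "0 < r\<^sup>2 * (1 - q) * (1 + q)"
    using assms by simp
  ultimately have "0 \<le> (q * r * x + (1 - q) * r * m - P)\<^sup>2 - (r * x - P)\<^sup>2 \<longleftrightarrow> 0 \<le> (m - x) * (x - b)"
    by (simp only: zero_le_mult_iff[of "_ * (1 + q)"]) auto
  also have "\<dots> \<longleftrightarrow> x \<in> {min m b..max m b}"
    by (auto simp: zero_le_mult_iff)
  finally show ?thesis
    by (simp add: abs_le_square_iff b_def withheld_interval_def)
qed

section \<open>Convexity of an antiderivative and integrals of the cdf\<close>

text \<open>By the mean value theorem the chord has slope \<open>G z\<close> for some
  \<open>z\<close> between \<open>a\<close> and \<open>b\<close>, and monotonicity compares it with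
  \<open>G b\<close>.\<close>

lemma antiderivative_above_tangent:
  fixes F G :: "real \<Rightarrow> real"
  assumes F: "\<And>x. (F has_real_derivative G x) (at x)" and "mono G"
  shows "F b + (a - b) * G b \<le> F a"
proof (cases a b rule: linorder_cases)
  case less
  then obtain z where "a < z" "z < b" "F b - F a = (b - a) * G z"
    using MVT2[of a b F G] F by blast
  moreover have "(b - a) * G z \<le> (b - a) * G b"
    using less \<open>z < b\<close> monoD[OF \<open>mono G\<close>, of z b] by (intro mult_left_mono) auto
  ultimately show ?thesis by (simp add: algebra_simps)
next
  case greater
  then obtain z where "b < z" "z < a" "F a - F b = (a - b) * G z"
    using MVT2[of b a F G] F by blast
  moreover have "(a - b) * G b \<le> (a - b) * G z"
    using greater \<open>b < z\<close> monoD[OF \<open>mono G\<close>, of b z] by (intro mult_left_mono) auto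
  ultimately show ?thesis by (simp add: algebra_simps)
qed simp

lemma LBINT_FTC:
  fixes F G :: "real \<Rightarrow> real"
  assumes "\<And>x. (F has_real_derivative G x) (at x)" "continuous_on UNIV G"
  shows "(LBINT x=a..b. G x) = F b - F a"
  using assms by (intro interval_integral_FTC_finite)
    (auto intro: continuous_on_subset has_vector_derivative_at_within
      simp: has_real_derivative_iff_has_vector_derivative)

lemma LBINT_diff_const:
  fixes F G :: "real \<Rightarrow> real"
  assumes F: "\<And>x. (F has_real_derivative G x) (at x)" and G: "continuous_on UNIV G"
  shows "(LBINT x=a..b. G x - k) = F b - F a - (b - a) * k"
proof -
  have "((\<lambda>x. F x - x * k) has_real_derivative G x - k) (at x)" for x
    by (auto intro!: derivative_eq_intros F)
  then have "(LBINT x=a..b. G x - k) = (F b - b * k) - (F a - a * k)"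
    using G by (intro LBINT_FTC) (auto intro: continuous_intros)
  then show ?thesis by (simp add: algebra_simps)
qed

section \<open>Monotonicity, existence and location of the root of \<open>excess\<close>\<close>

context
  fixes F G :: "real \<Rightarrow> real" and \<beta> q \<mu> c :: real
  assumes F: "\<And>x. (F has_real_derivative G x) (at x)" and G: "mono G"
    and \<beta>: "0 \<le> \<beta>" "\<beta> < 1" and q: "0 \<le> q" "q < 1"
begin

lemma bregman_nonneg: "0 \<le> bregman F G a b"
  using antiderivative_above_tangent[OF F G, of b a] by (simp add: bregman_def)

text \<open>The mirror point decreases in \<open>m\<close>, so moving \<open>m\<close> up towards
  \<open>c\<close> shrinks the interval from both ends; the integral of \<open>G b - G x\<close>
  over it loses both length and height.\<close>

lemma bregman_mirror_antimono:
  assumes "m \<le> m'" "m' \<le> c"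
  shows "bregman F G m' (mirror_point q c m') \<le> bregman F G m (mirror_point q c m)"
proof -
  define b b' where "b = mirror_point q c m" and "b' = mirror_point q c m'"
  have le: "m' \<le> b'" "b' \<le> b"
    using assms q mirror_ge[of q m' c] mirror_antimono[of q m m' c] by (auto simp: b_def b'_def)
  \<comment> \<open>The two products and the two tangent gaps below add up to exactly the difference
    of the divergences.\<close>
  have "0 \<le> (m' - m) * (G b' - G m')"
    using le assms monoD[OF G, of m' b'] by simp
  moreover have "0 \<le> (b' - m) * (G b - G b')"
    using le assms monoD[OF G, of b' b] by simp
  moreover have "F m' + (m - m') * G m' \<le> F m" "F b + (b' - b) * G b \<le> F b'"
    by (rule antiderivative_above_tangent[OF F G])+
  ultimately show ?thesis
    unfolding bregman_def b_def[symmetric] b'_def[symmetric] by (simp add: algebra_simps)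
qed

text \<open>Right of \<open>c\<close> a larger \<open>m\<close> widens the interval at both ends,
  and the increase of the divergence splits in the same way into two products and two tangent
  gaps.\<close>

lemma bregman_mirror_mono:
  assumes "c \<le> m" "m \<le> m'"
  shows "bregman F G m (mirror_point q c m) \<le> bregman F G m' (mirror_point q c m')"
proof -
  define b b' where "b = mirror_point q c m" and "b' = mirror_point q c m'"
  have le: "b \<le> m" "b' \<le> b"
    using assms q mirror_le[of q c m] mirror_antimono[of q m m' c] by (auto simp: b_def b'_def)
  have "0 \<le> (m' - m) * (G m - G b)"
    using le assms monoD[OF G, of b m] by simp
  moreover have "0 \<le> (m' - b) * (G b - G b')"
    using le assms monoD[OF G, of b' b] by simp
  moreover have "F m + (m' - m) * G m \<le> F m'" "F b' + (b - b') * G b' \<le> F b"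
    by (rule antiderivative_above_tangent[OF F G])+
  ultimately show ?thesis
    unfolding bregman_def b_def[symmetric] b'_def[symmetric] by (simp add: algebra_simps)
qed

text \<open>The linear term decreases strictly because \<beta> < 1, the signed divergence weakly.
  When \<open>c\<close> separates the two points, the signs of the two branches suffice.\<close>

lemma excess_strict_antimono:
  assumes "m < m'"
  shows "excess F G \<beta> q \<mu> c m' < excess F G \<beta> q \<mu> c m"
proof -
  have lin: "(1 - \<beta>) * (\<mu> - m') < (1 - \<beta>) * (\<mu> - m)"
    using assms \<beta> by simp
  consider "m' \<le> c" | "m \<le> c" "c < m'" | "c < m"
    by linarith
  then have "(if m' \<le> c then \<beta> else - \<beta>) * bregman F G m' (mirror_point q c m')
      \<le> (if m \<le> c then \<beta> else - \<beta>) * bregman F G m (mirror_point q c m)"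
  proof cases
    case 1
    then show ?thesis
      using assms \<beta> bregman_mirror_antimono[of m m'] by (simp add: mult_left_mono)
  next
    case 2
    then have "- \<beta> * bregman F G m' (mirror_point q c m') \<le> 0" "0 \<le> \<beta> * bregman F G m (mirror_point q c m)"
      using \<beta> by (simp_all add: bregman_nonneg)
    then show ?thesis using 2 by simp
  next
    case 3
    then show ?thesis
      using assms \<beta> mult_left_mono[OF bregman_mirror_mono[of m m'], of \<beta>] by simp
  qed
  with lin show ?thesis
    unfolding excess_def by linarith
qed

lemma excess_inj: "excess F G \<beta> q \<mu> c m = excess F G \<beta> q \<mu> c m' \<Longrightarrow> m = m'"
  by (metis excess_strict_antimono less_irrefl linorder_less_linear)

lemma excess_center: "excess F G \<beta> q \<mu> c c = (1 - \<beta>) * (\<mu> - c)"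
  using q by (simp add: excess_def bregman_def mirror_fixpoint)

text \<open>Intermediate value theorem between \<mu> and \<open>c\<close>: at \<mu> only the signed
  divergence is left, at \<open>c\<close> only the linear term, and their signs are weakly
  opposite.\<close>

lemma excess_root_exists:
  assumes "continuous_on UNIV G"
  shows "\<exists>m. excess F G \<beta> q \<mu> c m = 0"
proof -
  have cont: "continuous_on S (\<lambda>m. bregman F G m (mirror_point q c m))" for S
    unfolding bregman_def mirror_point_def using q
    by (intro continuous_intros continuous_on_compose2[OF assms]
        continuous_on_compose2[OF DERIV_continuous_on[of UNIV F G]]) (auto intro: F)
  show ?thesis
  proof (cases "\<mu> \<le> c")
    case True
    let ?h = "\<lambda>m. (1 - \<beta>) * (\<mu> - m) + \<beta> * bregman F G m (mirror_point q c m)"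
    have "\<exists>m\<ge>\<mu>. m \<le> c \<and> ?h m = 0"
      using True \<beta> bregman_nonneg excess_center
      by (intro IVT2' continuous_intros cont) (auto simp: excess_def mult_le_0_iff)
    then show ?thesis by (auto simp: excess_def)
  next
    case False
    \<comment> \<open>The right branch of \<open>excess\<close>, extended to \<open>c\<close> to be
      continuous on the closed interval; it agrees with \<open>excess\<close> at \<open>c\<close>
      because the divergence vanishes there.\<close>
    let ?h = "\<lambda>m. (1 - \<beta>) * (\<mu> - m) - \<beta> * bregman F G m (mirror_point q c m)"
    have *: "bregman F G c (mirror_point q c c) = 0"
      using q by (simp add: mirror_fixpoint bregman_def)
    have "\<exists>m\<ge>c. m \<le> \<mu> \<and> ?h m = 0"
      using False \<beta> bregman_nonneg *
      by (intro IVT2' continuous_intros cont) auto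
    then obtain m where "c \<le> m" "?h m = 0" by blast
    then have "excess F G \<beta> q \<mu> c m = 0"
      using * by (cases "m = c") (auto simp: excess_def)
    then show ?thesis ..
  qed
qed

text \<open>The sign of a strictly decreasing function at \<open>c\<close> tells on which side its
  root lies, and by \<open>excess_center\<close> this is the sign of
  \<open>\<mu> - c\<close>.\<close>

lemma excess_root_less_iff:
  assumes "excess F G \<beta> q \<mu> c m = 0"
  shows "m < c \<longleftrightarrow> \<mu> < c" "c < m \<longleftrightarrow> c < \<mu>"
proof -
  have "excess F G \<beta> q \<mu> c c < 0 \<longleftrightarrow> \<mu> < c" "0 < excess F G \<beta> q \<mu> c c \<longleftrightarrow> c < \<mu>"
    using \<beta> by (simp_all add: excess_center mult_less_0_iff zero_less_mult_iff)
  moreover have "m < c \<Longrightarrow> excess F G \<beta> q \<mu> c c < 0" "c < m \<Longrightarrow> 0 < excess F G \<beta> q \<mu> c c"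
    using excess_strict_antimono[of m c] excess_strict_antimono[of c m] assms by simp_all
  ultimately show "m < c \<longleftrightarrow> \<mu> < c" "c < m \<longleftrightarrow> c < \<mu>"
    using assms by (metis linorder_less_linear less_asym)+
qed

section \<open>The threshold systems as root problems\<close>

text \<open>The second threshold equation makes \<open>xu\<close> the mirror point of
  \<open>xl\<close>, the order \<open>xl \<le> xu\<close> then selects the left branch, and the
  first equation becomes a root of \<open>excess\<close>. Uniqueness of the thresholds thus reduces
  to uniqueness of the root.\<close>

lemma thresholds_low_iff:
  assumes "continuous_on UNIV G" "c = r0 * \<mu> / r"
  shows "thresholds_low G \<beta> q \<mu> r0 r xl xu \<longleftrightarrow>
    xl \<le> c \<and> xu = mirror_point q c xl \<and> excess F G \<beta> q \<mu> c xl = 0"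
proof -
  have "(LBINT x=xl..xu. G x - G xu) = - bregman F G xl xu"
    using LBINT_diff_const[OF F assms(1), of xl xu "G xu"] by (simp add: bregman_def algebra_simps)
  moreover have "xl \<le> mirror_point q c xl \<longleftrightarrow> xl \<le> c"
    using q mirror_ge[of q xl c] mirror_le[of q c xl] by linarith
  moreover have "xu = mirror_point q c xl \<longleftrightarrow> (1 + q) * xu + (1 - q) * xl = 2 * r0 * \<mu> / r"
    using q mirror_eq_iff[of q xu c xl] assms by (simp add: mult.assoc)
  ultimately show ?thesis
    by (auto simp: thresholds_low_def excess_def)
qed

lemma thresholds_high_iff:
  assumes "continuous_on UNIV G" "c = r0 * \<mu> / r"
  shows "thresholds_high G \<beta> q \<mu> r0 r xl xu \<longleftrightarrow>
    c \<le> xu \<and> xl = mirror_point q c xu \<and> excess F G \<beta> q \<mu> c xu = 0"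
proof -
  have "(LBINT x=xl..xu. G x - G xl) = bregman F G xu xl"
    using LBINT_diff_const[OF F assms(1), of xl xu "G xl"] by (simp add: bregman_def algebra_simps)
  moreover have "mirror_point q c xu \<le> xu \<longleftrightarrow> c \<le> xu"
    using q mirror_ge[of q xu c] mirror_le[of q c xu] by linarith
  moreover have "xl = mirror_point q c xu \<longleftrightarrow> (1 - q) * xu + (1 + q) * xl = 2 * r0 * \<mu> / r"
    using q mirror_eq_iff[of q xl c xu] assms by (simp add: add.commute mult.assoc)
  \<comment> \<open>For \<open>xu = c\<close> the definition of \<open>excess\<close> takes its
    other branch, but the divergence is zero there.\<close>
  moreover have "excess F G \<beta> q \<mu> c xu = (1 - \<beta>) * (\<mu> - xu) - \<beta> * bregman F G xu (mirror_point q c xu)"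
    if "c \<le> xu"
    using that q by (cases "xu = c") (auto simp: excess_def bregman_def mirror_fixpoint)
  ultimately show ?thesis
    by (auto simp: thresholds_high_def)
qed

end


text \<open>Fubini for the indicator of \<open>a \<le> t < x \<le> b\<close>; integration by parts without a continuous density.\<close>

lemma (in finite_borel_measure) set_integral_cdf_diff:
  assumes "a \<le> b"
  shows "(LINT x:{a..b}|M. x - a) = (LINT t:{a..b}|lborel. cdf M b - cdf M t)"
proof -
  have meas[measurable]: "cdf M \<in> borel_measurable borel"
    by (intro borel_measurable_mono monoI cdf_nondecreasing)
  interpret P: pair_sigma_finite M lborel
    by unfold_locales
  have sets_pair: "sets (M \<Otimes>\<^sub>M lborel) = sets (borel \<Otimes>\<^sub>M borel)"
    using M_is_borel by (intro sets_pair_measure_cong) simp_all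
  have "{p \<in> space (borel \<Otimes>\<^sub>M borel). a \<le> snd p \<and> snd p < fst p \<and> fst p \<le> b}
      \<in> sets (borel \<Otimes>\<^sub>M borel :: (real \<times> real) measure)"
    by measurable
  then have ind: "(\<lambda>(x, t). indicator {(x, t). a \<le> t \<and> t < x \<and> x \<le> b} (x, t) :: ennreal)
      \<in> borel_measurable (M \<Otimes>\<^sub>M lborel)"
    unfolding case_prod_eta by (intro borel_measurable_indicator)
      (simp add: sets_pair[simplified] space_pair_measure case_prod_unfold)
  have "(LINT x:{a..b}|M. x - a) = enn2real (\<integral>\<^sup>+x. ennreal (indicator {a..b} x * (x - a)) \<partial>M)"
    unfolding set_lebesgue_integral_def real_scaleR_def using M_is_borel
    by (subst integral_eq_nn_integral)
      (auto simp: indicator_def simp del: indicator_simps cong: measurable_cong_sets)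
  also have "(\<integral>\<^sup>+x. ennreal (indicator {a..b} x * (x - a)) \<partial>M)
      = (\<integral>\<^sup>+x. \<integral>\<^sup>+t. indicator {(x, t). a \<le> t \<and> t < x \<and> x \<le> b} (x, t) \<partial>lborel \<partial>M)"
  proof (intro nn_integral_cong)
    fix x
    have "(\<integral>\<^sup>+t. indicator {(x, t). a \<le> t \<and> t < x \<and> x \<le> b} (x, t) \<partial>lborel)
        = (\<integral>\<^sup>+t. indicator (if x \<le> b then {a..<x} else {}) t \<partial>lborel)"
      by (intro nn_integral_cong) (auto simp: indicator_def)
    also have "\<dots> = ennreal (indicator {a..b} x * (x - a))"
      by (cases "a \<le> x") auto
    finally show "ennreal (indicator {a..b} x * (x - a))
        = (\<integral>\<^sup>+t. indicator {(x, t). a \<le> t \<and> t < x \<and> x \<le> b} (x, t) \<partial>lborel)" ..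
  qed
  also have "\<dots> = (\<integral>\<^sup>+t. \<integral>\<^sup>+x. indicator {(x, t). a \<le> t \<and> t < x \<and> x \<le> b} (x, t) \<partial>M \<partial>lborel)"
    using ind by (rule P.Fubini'[symmetric])
  also have "\<dots> = (\<integral>\<^sup>+t. ennreal (indicator {a..b} t * (cdf M b - cdf M t)) \<partial>lborel)"
  proof (intro nn_integral_cong)
    \<comment> \<open>The strict inequality \<open>t < x\<close> makes the section
      \<open>{t<..b}\<close> half-open, so its mass is a difference of cdf values even if
      \<open>M\<close> has atoms.\<close>
    fix t
    have "(\<integral>\<^sup>+x. indicator {(x, t). a \<le> t \<and> t < x \<and> x \<le> b} (x, t) \<partial>M)
        = (\<integral>\<^sup>+x. indicator (if a \<le> t then {t<..b} else {}) x \<partial>M)"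
      by (intro nn_integral_cong) (auto simp: indicator_def)
    also have "\<dots> = ennreal (indicator {a..b} t * (cdf M b - cdf M t))"
      using cdf_diff_eq[of t b] M_is_borel
      by (cases "a \<le> t"; cases t b rule: linorder_cases) (auto simp: emeasure_eq_measure)
    finally show "(\<integral>\<^sup>+x. indicator {(x, t). a \<le> t \<and> t < x \<and> x \<le> b} (x, t) \<partial>M)
        = ennreal (indicator {a..b} t * (cdf M b - cdf M t))" .
  qed
  also have "enn2real \<dots> = (LINT t:{a..b}|lborel. cdf M b - cdf M t)"
    unfolding set_lebesgue_integral_def real_scaleR_def
    by (subst integral_eq_nn_integral) (auto simp: indicator_def cdf_nondecreasing)
  finally show ?thesis .
qed

section \<open>Bayes' rule on an interval, from the density of \<open>X\<close>\<close>

context prob_space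
begin

context
  fixes X :: "'a \<Rightarrow> real" and g G :: "real \<Rightarrow> real"
  assumes X: "distributed M lborel X (\<lambda>x. ennreal (g x))" and g: "\<And>x. 0 \<le> g x"
    and G: "G = cdf (distr M borel X)"
begin

lemma distr_X_density: "distr M borel X = density lborel (\<lambda>x. ennreal (g x))"
  using distributed_distr_eq_density[OF X] by (simp cong: distr_cong)

lemma X_borel_measurable: "X \<in> borel_measurable M"
  using distributed_measurable[OF X] by simp

lemma real_distribution_X: "real_distribution (distr M borel X)"
  using X_borel_measurable by (rule real_distribution_distr)

lemma cdf_mono: "mono G"
  unfolding G using real_distribution_X
  by (intro monoI finite_borel_measure.cdf_nondecreasing)
    (auto simp: real_distribution.finite_borel_measure_M)

text \<open>A law with a density has no atoms, and a cdf jumps only at atoms.\<close>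

lemma cdf_continuous: "continuous_on UNIV G"
proof -
  interpret D: real_distribution "distr M borel X" by (rule real_distribution_X)
  have "emeasure (distr M borel X) {x} = 0" for x
  proof -
    have "AE y in lborel. y \<in> {x} \<longrightarrow> ennreal (g y) = 0"
      using AE_lborel_singleton[of x] by eventually_elim auto
    then have "{x} \<in> null_sets (density lborel (\<lambda>x. ennreal (g x)))"
      using distributed_borel_measurable[OF X] by (subst null_sets_density_iff) auto
    then show ?thesis
      unfolding distr_X_density by auto
  qed
  then show ?thesis
    by (auto simp: G continuous_on_eq_continuous_at D.isCont_cdf measure_def)
qed

lemma set_integral_distr_density:
  assumes "A \<in> sets borel" "h \<in> borel_measurable borel"
  shows "(LINT x:A|distr M borel X. h x) = (LINT x:A|lborel. h x * g x)"
proof -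
  have "g \<in> borel_measurable borel"
    using distributed_real_measurable[OF _ X] g by simp
  then show ?thesis
    unfolding distr_X_density set_lebesgue_integral_def using assms g
    by (subst integral_real_density) (auto simp: mult_ac)
qed

lemma set_integral_density:
  assumes "a \<le> b"
  shows "(LINT x:{a..b}|lborel. g x) = G b - G a"
proof -
  interpret D: real_distribution "distr M borel X" by (rule real_distribution_X)
  have "(LINT x:{a..b}|lborel. g x) = measure (distr M borel X) {a..b}"
    using set_integral_distr_density[of "{a..b}" "\<lambda>_. 1"]
    by (simp add: set_lebesgue_integral_def)
  \<comment> \<open>Differences of the cdf measure half-open intervals, so the left endpoint is
    split off; it carries no mass.\<close>
  also have "\<dots> = measure (distr M borel X) {a<..b} + measure (distr M borel X) {a}"
    using assms by (subst D.finite_measure_Union[symmetric]) (auto intro!: arg_cong[where f="measure _"])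
  also have "measure (distr M borel X) {a} = 0"
    using cdf_continuous by (simp add: G continuous_on_eq_continuous_at flip: D.isCont_cdf)
  also have "measure (distr M borel X) {a<..b} = G b - G a"
    using assms D.cdf_diff_eq[of a b] by (cases "a = b") (auto simp: G)
  finally show ?thesis by simp
qed

lemma set_integral_identity_density:
  fixes F :: "real \<Rightarrow> real"
  assumes "integrable M X" and F: "\<And>x. (F has_real_derivative G x) (at x)" and "a \<le> b"
  shows "(LINT x:{a..b}|lborel. x * g x) = b * G b - a * G a - (F b - F a)"
proof -
  interpret D: real_distribution "distr M borel X" by (rule real_distribution_X)
  have gm: "g \<in> borel_measurable borel"
    using distributed_real_measurable[OF _ X] g by simp
  have "integrable lborel (\<lambda>x. x * g x)" "integrable lborel g"
    using distributed_integrable[OF X, of "\<lambda>x. x"] distributed_integrable[OF X, of "\<lambda>x. 1"]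
      g assms(1) by (simp_all add: mult.commute)
  then have int: "set_integrable lborel {a..b} (\<lambda>x. x * g x)" "set_integrable lborel {a..b} g"
    unfolding set_integrable_def by (simp_all add: integrable_mult_indicator del: real_scaleR_def)
  have Gint: "set_integrable lborel {a..b} G"
    by (intro borel_integrable_atLeastAtMost' continuous_on_subset[OF cdf_continuous]) auto
  \<comment> \<open>Subtracting \<open>a\<close> times the mass produces the integrand
    \<open>x - a\<close> of \<open>set_integral_cdf_diff\<close>, nonnegative on the
    interval.\<close>
  have "(LINT x:{a..b}|lborel. x * g x) - a * (G b - G a)
      = (LINT x:{a..b}|lborel. x * g x - a * g x)"
    using int assms by (simp add: set_integral_density)
  also have "\<dots> = (LINT x:{a..b}|distr M borel X. x - a)"
    by (subst set_integral_distr_density) (auto simp: algebra_simps)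
  also have "\<dots> = (LINT x:{a..b}|lborel. G b - G x)"
    using D.set_integral_cdf_diff[OF \<open>a \<le> b\<close>] by (simp add: G)
  also have "\<dots> = (b - a) * G b - (LBINT x=a..b. G x)"
    using Gint \<open>a \<le> b\<close> borel_integrable_atLeastAtMost'[of a b "\<lambda>_. G b"]
    by (simp add: interval_integral_Icc) (simp add: set_lebesgue_integral_def)
  also have "(LBINT x=a..b. G x) = F b - F a"
    using F cdf_continuous by (rule LBINT_FTC)
  finally show ?thesis by (simp add: algebra_simps)
qed

text \<open>The denominator is positive because \<beta> < 1, so it can be cleared. The terms with
  \<open>G m\<close> then cancel and \<open>G\<close> survives only at the mirror point, as in the
  divergence.\<close>

lemma bayes_belief_iff:
  fixes F :: "real \<Rightarrow> real"
  assumes "integrable M X" and F: "\<And>x. (F has_real_derivative G x) (at x)"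
    and \<beta>: "0 \<le> \<beta>" "\<beta> < 1" and q: "0 \<le> q" "q < 1"
  shows "m = bayes_belief \<beta> g \<mu> (withheld_interval q c m) \<longleftrightarrow>
    excess F G \<beta> q \<mu> c m = 0"
proof -
  define b where "b = mirror_point q c m"
  define lo hi where "lo = min m b" and "hi = max m b"
  have "lo \<le> hi" by (simp add: lo_def hi_def)
  then have pos: "0 < 1 - \<beta> + \<beta> * (G hi - G lo)"
    using \<beta> monoD[OF cdf_mono, of lo hi] by (intro add_pos_nonneg) auto
  have "m = bayes_belief \<beta> g \<mu> {lo..hi} \<longleftrightarrow>
      m = ((1 - \<beta>) * \<mu> + \<beta> * (hi * G hi - lo * G lo - (F hi - F lo))) /
        (1 - \<beta> + \<beta> * (G hi - G lo))"
    using \<open>lo \<le> hi\<close>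
    by (simp add: bayes_belief_def set_integral_density set_integral_identity_density[OF assms(1) F])
  also have "\<dots> \<longleftrightarrow> m * (1 - \<beta> + \<beta> * (G hi - G lo)) =
      (1 - \<beta>) * \<mu> + \<beta> * (hi * G hi - lo * G lo - (F hi - F lo))"
    using pos by (simp add: eq_divide_eq)
  also have "\<dots> \<longleftrightarrow> excess F G \<beta> q \<mu> c m = 0"
  proof (cases "m \<le> c")
    case True
    then have "lo = m" "hi = b"
      using q mirror_ge[of q m c] by (auto simp: lo_def hi_def b_def)
    then show ?thesis
      using True unfolding excess_def bregman_def b_def[symmetric] by (auto simp: algebra_simps)
  next
    case False
    then have "lo = b" "hi = m"
      using q mirror_le[of q c m] by (auto simp: lo_def hi_def b_def)
    then show ?thesis
      using False unfolding excess_def bregman_def b_def[symmetric] by (auto simp: algebra_simps)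
  qed
  finally show ?thesis
    by (simp add: lo_def hi_def b_def withheld_interval_def)
qed

end

end

section \<open>Optimal positions and the sign of the gain\<close>

lemma informed_profit_eq:
  assumes "0 \<le> q" "q < 1"
  shows "informed_profit q P r m \<rho> d x =
    (if d then r * x - P else q * r * x + (1 - q) * r * m - P) * \<rho>"
  using assms by (auto simp: informed_profit_def closing_price_def algebra_simps)

lemma (in prob_space) partial_profit_eq:
  assumes "0 \<le> q" "q < 1" "integrable M X"
  shows "partial_profit M X q P r m \<rho> = (q * r * expectation X + (1 - q) * r * m - P) * \<rho>"
  using assms by (simp add: partial_profit_def informed_profit_eq prob_space)

text \<open>Expected profit is linear in the position, with \<open>v\<close> the expected price
  change per unit; a nonzero \<open>v\<close> therefore forces an extreme position.\<close>

definition best_position :: "real \<Rightarrow> real \<Rightarrow> bool" where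
  "best_position v \<rho> \<longleftrightarrow> \<rho> \<in> {-1..1} \<and> (\<forall>\<rho>'\<in>{-1..1}. v * \<rho>' \<le> v * \<rho>)"

lemma best_position_iff: "best_position v \<rho> \<longleftrightarrow> \<rho> \<in> {-1..1} \<and> v * \<rho> = \<bar>v\<bar>"
proof -
  have le: "v * \<rho>' \<le> \<bar>v\<bar>" if "\<rho>' \<in> {-1..1}" for \<rho>'
  proof -
    have "\<bar>v\<bar> * \<bar>\<rho>'\<bar> \<le> \<bar>v\<bar> * 1"
      using that by (intro mult_left_mono) auto
    then show ?thesis
      by (metis abs_ge_self abs_mult mult.right_neutral order_trans)
  qed
  moreover have "v * sgn v = \<bar>v\<bar>" "sgn v \<in> {-1..1}"
    by (auto simp: sgn_if)
  ultimately show ?thesis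
    unfolding best_position_def by (metis order_antisym)
qed

lemma best_position_pos: "0 < v \<Longrightarrow> best_position v \<rho> \<longleftrightarrow> \<rho> = 1"
  by (auto simp: best_position_iff)

lemma best_position_neg: "v < 0 \<Longrightarrow> best_position v \<rho> \<longleftrightarrow> \<rho> = -1"
  using mult_left_cancel[of v \<rho> "-1"] by (auto simp: best_position_iff)

lemma best_position_sgn: "best_position v (sgn v)"
  by (auto simp: best_position_iff sgn_if)

lemma best_position_unique:
  "v \<noteq> 0 \<Longrightarrow> best_position v \<rho> \<Longrightarrow> best_position v \<rho>' \<Longrightarrow> \<rho> = \<rho>'"
  by (metis best_position_iff mult_left_cancel)

text \<open>For fixed \<open>d\<close> the best attainable value is \<open>\<bar>v d\<bar>\<close>;
  once \<open>d0\<close> maximises it, only the position is left to choose. This is why the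
  withholding rule compares absolute values.\<close>

lemma best_joint_choice_iff:
  fixes v :: "bool \<Rightarrow> real"
  assumes "\<And>d. \<bar>v d\<bar> \<le> \<bar>v d0\<bar>"
  shows "\<rho> \<in> {-1..1} \<and> (\<forall>\<rho>'\<in>{-1..1}. \<forall>d. v d * \<rho>' \<le> v d0 * \<rho>) \<longleftrightarrow> best_position (v d0) \<rho>"
proof -
  have "v d * \<rho>' \<le> v d0 * \<rho>" if "best_position (v d0) \<rho>" "\<rho>' \<in> {-1..1}" for d \<rho>'
  proof -
    have "v d * \<rho>' \<le> v d * sgn (v d)"
      using best_position_sgn that(2) unfolding best_position_def by blast
    also have "\<dots> = \<bar>v d\<bar>"
      by (simp add: sgn_if)
    also have "\<dots> \<le> v d0 * \<rho>"
      using assms[of d] that(1) by (simp add: best_position_iff)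
    finally show ?thesis .
  qed
  then show ?thesis
    unfolding best_position_def by blast
qed

text \<open>The informed investor's expected price change per unit held long, under the interval
  disclosure rule.\<close>

definition gain :: "real \<Rightarrow> real \<Rightarrow> real \<Rightarrow> real \<Rightarrow> real \<Rightarrow> real" where
  "gain q P r m x =
     (if x \<in> withheld_interval q (P / r) m then q * r * x + (1 - q) * r * m - P else r * x - P)"

context
  fixes q r c P m :: real
  assumes q: "0 \<le> q" "q < 1" and r: "0 < r" and P: "P = r * c"
begin

lemma price_ratio: "P / r = c"
  using r by (simp add: P)

lemma gain_below:
  assumes "x < min m (mirror_point q c m)"
  shows "x \<notin> withheld_interval q c m" "gain q P r m x < 0"
proof -
  show *: "x \<notin> withheld_interval q c m"
    using assms by (auto simp: withheld_interval_def)
  \<comment> \<open>\<open>c\<close> lies between \<open>m\<close> and its mirror point, hence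
    inside the withheld interval.\<close>
  have "x < c"
    using assms mirror_le[OF q, of c m] by (cases "m \<le> c") auto
  then show "gain q P r m x < 0"
    using * r by (simp add: gain_def price_ratio) (simp add: P)
qed

lemma gain_above:
  assumes "max m (mirror_point q c m) < x"
  shows "x \<notin> withheld_interval q c m" "0 < gain q P r m x"
proof -
  show *: "x \<notin> withheld_interval q c m"
    using assms by (auto simp: withheld_interval_def)
  have "c < x"
    using assms mirror_ge[OF q, of m c] by (cases "m \<le> c") auto
  then show "0 < gain q P r m x"
    using * r by (simp add: gain_def price_ratio) (simp add: P)
qed

text \<open>Divided by \<open>r\<close>, the gain is \<open>q * x + (1 - q) * m - c\<close>. On the
  interval it is largest at the mirror point \<open>b\<close>, where it equals \<open>c - b\<close>,
  and \<open>c < b\<close> because \<open>m < c\<close>.\<close>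

lemma gain_withheld_neg:
  assumes "x \<in> withheld_interval q c m" "m < c"
  shows "gain q P r m x < 0"
proof -
  define b where "b = mirror_point q c m"
  have b: "(1 + q) * b + (1 - q) * m = 2 * c"
    using mirror_eq_iff[OF q(1), of b c m] b_def by simp
  have m: "(1 - q) * m < (1 - q) * c"
    using assms q by simp
  then have "(1 + q) * c < (1 + q) * b"
    using b by (simp add: algebra_simps)
  then have "c < b"
    using q by simp
  have "x \<le> b"
    using assms \<open>c < b\<close> by (simp add: withheld_interval_def b_def)
  then have "q * x \<le> q * b"
    using q by (simp add: mult_left_mono)
  then have "q * x + (1 - q) * m - c < 0"
    using b \<open>c < b\<close> by (simp add: algebra_simps)
  then have "r * (q * x + (1 - q) * m - c) < 0"
    using r by (simp add: mult_less_0_iff)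
  then show ?thesis
    using assms by (simp add: gain_def price_ratio) (simp add: P algebra_simps)
qed

text \<open>Here \<open>b\<close> is the left end, so the gain divided by \<open>r\<close> is
  smallest there, again with value \<open>c - b\<close>, now positive.\<close>

lemma gain_withheld_pos:
  assumes "x \<in> withheld_interval q c m" "c < m"
  shows "0 < gain q P r m x"
proof -
  define b where "b = mirror_point q c m"
  have b: "(1 + q) * b + (1 - q) * m = 2 * c"
    using mirror_eq_iff[OF q(1), of b c m] b_def by simp
  have m: "(1 - q) * c < (1 - q) * m"
    using assms q by simp
  then have "(1 + q) * b < (1 + q) * c"
    using b by (simp add: algebra_simps)
  then have "b < c"
    using q by simp
  have "b \<le> x"
    using assms \<open>b < c\<close> by (simp add: withheld_interval_def b_def)
  then have "q * b \<le> q * x"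
    using q by (simp add: mult_left_mono)
  then have "0 < q * x + (1 - q) * m - c"
    using b \<open>b < c\<close> by (simp add: algebra_simps)
  then have "0 < r * (q * x + (1 - q) * m - c)"
    using r by simp
  then show ?thesis
    using assms by (simp add: gain_def price_ratio) (simp add: P algebra_simps)
qed

text \<open>A nonzero gain admits only one best position, which yields uniqueness of the
  equilibrium. For \<open>m = c\<close> the interval is \<open>{c}\<close>, where the gain is zero
  and every position is optimal.\<close>

lemma gain_nonzero:
  assumes "m \<noteq> c"
  shows "gain q P r m x \<noteq> 0"
proof (cases "x \<in> withheld_interval q c m")
  case True
  then show ?thesis
    using assms gain_withheld_neg gain_withheld_pos by (cases "m < c") force+
next
  case False
  then have "x < min m (mirror_point q c m) \<or> max m (mirror_point q c m) < x"
    by (auto simp: withheld_interval_def)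
  then show ?thesis
    using gain_below(2) gain_above(2) by force
qed

end

section \<open>Existence, uniqueness and shape of the equilibrium\<close>

text \<open>Withholding exactly on the interval maximises the absolute expected price change, so
  joint optimality of disclosure and position reduces to a best position against
  \<open>gain\<close>.\<close>

lemma (in prob_space) is_equilibrium_iff:
  assumes q: "0 \<le> q" "q < 1" and r: "0 < r" and X: "integrable M X"
  shows "is_equilibrium M X g \<beta> q \<mu>0 P r s \<longleftrightarrow>
    withheld s = withheld_interval q (P / r) (belief s) \<and>
    (\<forall>x. best_position (gain q P r (belief s) x) (informed_position s x)) \<and>
    best_position (q * r * expectation X + (1 - q) * r * belief s - P) (partial_position s) \<and>
    belief s = bayes_belief \<beta> g \<mu>0 (withheld s)"
proof -
  define m where "m = belief s"
  define v where "v x d = (if d then r * x - P else q * r * x + (1 - q) * r * m - P)" for x d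
  have between: "\<bar>r * x - P\<bar> \<le> \<bar>q * r * x + (1 - q) * r * m - P\<bar> \<longleftrightarrow>
      x \<in> withheld_interval q (P / r) m" for x
    using withhold_iff_between[OF q r] .
  have informed: "informed_position s x \<in> {-1..1} \<and> (\<forall>\<rho>\<in>{-1..1}. \<forall>d.
      informed_profit q P r m \<rho> d x \<le> informed_profit q P r m (informed_position s x) (x \<notin> withheld s) x) \<longleftrightarrow>
      best_position (gain q P r m x) (informed_position s x)"
    if W: "withheld s = withheld_interval q (P / r) m" for x
  proof -
    have "\<bar>v x d\<bar> \<le> \<bar>v x (x \<notin> withheld s)\<bar>" for d
      using between[of x] by (auto simp: v_def W)
    moreover have "gain q P r m x = v x (x \<notin> withheld s)"
      by (simp add: gain_def v_def W)
    ultimately show ?thesis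
      using best_joint_choice_iff[of "v x" "x \<notin> withheld s"]
      by (simp add: informed_profit_eq[OF q] v_def[symmetric])
  qed
  show ?thesis
    unfolding is_equilibrium_def m_def[symmetric] between Collect_mem_eq
      partial_profit_eq[OF q X] best_position_def[of "_ - P"]
    using informed by blast
qed

theorem proposition2:
  fixes M :: "'w measure" and R X :: "'w \<Rightarrow> real" and f g G :: "real \<Rightarrow> real"
    and r0 \<mu>0 P1 \<beta> q r :: real
  assumes "prob_space M"
    and indep: "prob_space.indep_var M borel R borel X"
    and R_density: "distributed M lborel R (\<lambda>y. ennreal (f y))" "\<And>y. 0 \<le> f y"
    and R_pos: "AE w in M. 0 < R w"
    and R_mean: "integrable M R" "prob_space.expectation M R = r0"
    and X_density: "distributed M lborel X (\<lambda>x. ennreal (g x))" "\<And>x. 0 \<le> g x"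
    and X_cdf: "G = cdf (distr M borel X)"
    and X_mean: "integrable M X" "prob_space.expectation M X = \<mu>0" "0 < \<mu>0"
    and P1: "P1 = prob_space.expectation M (\<lambda>w. R w * X w)"
    and \<beta>: "0 \<le> \<beta>" "\<beta> < 1"
    and q: "0 \<le> q" "q < 1"
    and r: "0 < r"
  shows "\<exists>xl xu. xl \<le> xu \<and>
    (\<exists>s. is_equilibrium M X g \<beta> q \<mu>0 P1 r s) \<and>
    (r \<noteq> r0 \<longrightarrow> (\<exists>!s. is_equilibrium M X g \<beta> q \<mu>0 P1 r s)) \<and>
    (\<forall>s. is_equilibrium M X g \<beta> q \<mu>0 P1 r s \<longrightarrow>
       (\<forall>x. x < xl \<longrightarrow> informed_position s x < 0 \<and> x \<notin> withheld s) \<and>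
       (\<forall>x. xu < x \<longrightarrow> 0 < informed_position s x \<and> x \<notin> withheld s) \<and>
       (\<forall>x\<in>{xl..xu}. x \<in> withheld s \<and>
          (r < r0 \<longrightarrow> informed_position s x < 0) \<and>
          (r0 < r \<longrightarrow> 0 < informed_position s x)) \<and>
       (r < r0 \<longrightarrow> partial_position s < 0) \<and>
       (r0 < r \<longrightarrow> 0 < partial_position s)) \<and>
    (r < r0 \<longrightarrow> thresholds_low G \<beta> q \<mu>0 r0 r xl xu \<and>
       (\<forall>xl' xu'. thresholds_low G \<beta> q \<mu>0 r0 r xl' xu' \<longrightarrow> xl' = xl \<and> xu' = xu)) \<and>
    (r0 < r \<longrightarrow> thresholds_high G \<beta> q \<mu>0 r0 r xl xu \<and>
       (\<forall>xl' xu'. thresholds_high G \<beta> q \<mu>0 r0 r xl' xu' \<longrightarrow> xl' = xl \<and> xu' = xu))"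
proof -
  interpret prob_space M by fact
  define c where "c = P1 / r"
  have "P1 = r0 * \<mu>0"
    using indep_var_lebesgue_integral[OF indep R_mean(1) X_mean(1)] R_mean X_mean P1 by simp
  then have c: "c = r0 * \<mu>0 / r"
    by (simp add: c_def)
  have P: "P1 = r * c"
    using r by (simp add: c_def)
  have lt: "\<mu>0 < c \<longleftrightarrow> r < r0" "c < \<mu>0 \<longleftrightarrow> r0 < r"
    using r \<open>0 < \<mu>0\<close> by (auto simp: c field_simps)
  note mono = cdf_mono[OF X_density X_cdf] and cont = cdf_continuous[OF X_density X_cdf]
  \<comment> \<open>Only differences of \<open>F\<close> enter, so any antiderivative of the
    continuous \<open>G\<close> serves.\<close>
  obtain F where F: "\<And>x. (F has_real_derivative G x) (at x)"
    using einterval_antiderivative[of "-\<infinity>" "\<infinity>" G] cont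
    by (auto simp: continuous_on_eq_continuous_at has_real_derivative_iff_has_vector_derivative)
  obtain m where m: "excess F G \<beta> q \<mu>0 c m = 0"
    using excess_root_exists[OF F mono \<beta> q cont] by blast
  have m_unique: "excess F G \<beta> q \<mu>0 c m' = 0 \<longleftrightarrow> m' = m" for m'
    using excess_inj[OF F mono \<beta> q] m by metis
  have less_iff: "m < c \<longleftrightarrow> r < r0" "c < m \<longleftrightarrow> r0 < r"
    using excess_root_less_iff[OF F mono \<beta> q m] lt by auto
  define v where "v = q * r * \<mu>0 + (1 - q) * r * m - P1"
  have equilibrium: "is_equilibrium M X g \<beta> q \<mu>0 P1 r s \<longleftrightarrow>
      belief s = m \<and> withheld s = withheld_interval q c m \<and>
      (\<forall>x. best_position (gain q P1 r m x) (informed_position s x)) \<and>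
      best_position v (partial_position s)" for s
    unfolding is_equilibrium_iff[OF q r X_mean(1)] X_mean(2) c_def[symmetric] v_def
    using bayes_belief_iff[OF X_density X_cdf X_mean(1) F \<beta> q, of "belief s" \<mu>0 c] m_unique
    by metis
  \<comment> \<open>Up to the factor \<open>r\<close>, \<open>v\<close> is a weighted average of
    \<open>\<mu>0 - c\<close> and \<open>m - c\<close>, which have the same sign; the second has
    positive weight \<open>1 - q\<close>, so \<open>v\<close> inherits that sign strictly.\<close>
  have v_eq: "v = r * (q * (\<mu>0 - c) + (1 - q) * (m - c))"
    by (simp add: v_def P algebra_simps)
  have v_neg: "v < 0" if "r < r0"
  proof -
    have "q * (\<mu>0 - c) \<le> 0" "(1 - q) * (m - c) < 0"
      using that lt less_iff q by (auto simp: mult_le_0_iff mult_less_0_iff)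
    then have "q * (\<mu>0 - c) + (1 - q) * (m - c) < 0"
      by (rule add_nonpos_neg)
    then show ?thesis using r by (simp only: v_eq mult_less_0_iff) simp
  qed
  have v_pos: "0 < v" if "r0 < r"
  proof -
    have "0 \<le> q * (\<mu>0 - c)" "0 < (1 - q) * (m - c)"
      using that lt less_iff q by auto
    then have "0 < q * (\<mu>0 - c) + (1 - q) * (m - c)"
      by (rule add_nonneg_pos)
    then show ?thesis using r by (simp only: v_eq zero_less_mult_iff) simp
  qed
  \<comment> \<open>\<open>sgn\<close> gives a best position for every slope, zero included, so this
    profile is an equilibrium for \<open>r = r0\<close> too.\<close>
  define s0 where "s0 = \<lparr>informed_position = (\<lambda>x. sgn (gain q P1 r m x)),
    withheld = withheld_interval q c m, partial_position = sgn v, belief = m\<rparr>"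
  have s0: "is_equilibrium M X g \<beta> q \<mu>0 P1 r s0"
    by (simp add: equilibrium s0_def best_position_sgn)
  have unique: "s = s0" if "r \<noteq> r0" and s: "is_equilibrium M X g \<beta> q \<mu>0 P1 r s" for s
  proof (rule profile.equality)
    have "m \<noteq> c" "v \<noteq> 0"
      using that less_iff v_neg v_pos by force+
    show "informed_position s = informed_position s0"
    proof
      fix x
      show "informed_position s x = informed_position s0 x"
        using gain_nonzero[OF q r P \<open>m \<noteq> c\<close>, of x] s s0 unfolding equilibrium
        by (blast intro: best_position_unique)
    qed
    show "partial_position s = partial_position s0"
      using \<open>v \<noteq> 0\<close> s s0 unfolding equilibrium by (blast intro: best_position_unique)
    show "withheld s = withheld s0" "belief s = belief s0"
      using s s0 unfolding equilibrium by simp_all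
  qed simp
  define xl xu where "xl = min m (mirror_point q c m)" and "xu = max m (mirror_point q c m)"
  have W: "withheld_interval q c m = {xl..xu}"
    by (simp add: withheld_interval_def xl_def xu_def)
  have low: "xl = m" "xu = mirror_point q c m" if "m \<le> c"
    using that mirror_ge[OF q that] by (auto simp: xl_def xu_def)
  have high: "xl = mirror_point q c m" "xu = m" if "c \<le> m"
    using that mirror_le[OF q that] by (auto simp: xl_def xu_def)
  show ?thesis
  proof (rule exI[of _ xl], rule exI[of _ xu], intro conjI impI allI)
    show "xl \<le> xu" by (simp add: xl_def xu_def)
    show "\<exists>s. is_equilibrium M X g \<beta> q \<mu>0 P1 r s" using s0 ..
    show "\<exists>!s. is_equilibrium M X g \<beta> q \<mu>0 P1 r s" if "r \<noteq> r0"
      using s0 unique[OF that] by blast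
  next
    fix s
    assume s: "is_equilibrium M X g \<beta> q \<mu>0 P1 r s"
    then have withheld: "withheld s = withheld_interval q c m"
      and informed: "\<And>x. best_position (gain q P1 r m x) (informed_position s x)"
      and partial: "best_position v (partial_position s)"
      unfolding equilibrium by auto
    show "informed_position s x < 0" "x \<notin> withheld s" if "x < xl" for x
      using gain_below[OF q r P, of x m] that informed[of x]
      by (auto simp: xl_def withheld best_position_neg)
    show "0 < informed_position s x" "x \<notin> withheld s" if "xu < x" for x
      using gain_above[OF q r P, of m x] that informed[of x]
      by (auto simp: xu_def withheld best_position_pos)
    show "\<forall>x\<in>{xl..xu}. x \<in> withheld s \<and> (r < r0 \<longrightarrow> informed_position s x < 0) \<and>
        (r0 < r \<longrightarrow> 0 < informed_position s x)"
    proof (intro ballI conjI impI)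
      fix x
      assume "x \<in> {xl..xu}"
      then have x: "x \<in> withheld_interval q c m" by (simp add: W)
      then show "x \<in> withheld s" by (simp add: withheld)
      show "informed_position s x < 0" if "r < r0"
        using gain_withheld_neg[OF q r P x] that less_iff informed[of x]
        by (simp add: best_position_neg)
      show "0 < informed_position s x" if "r0 < r"
        using gain_withheld_pos[OF q r P x] that less_iff informed[of x]
        by (simp add: best_position_pos)
    qed
    show "partial_position s < 0" if "r < r0"
      using partial v_neg[OF that] by (simp add: best_position_neg)
    show "0 < partial_position s" if "r0 < r"
      using partial v_pos[OF that] by (simp add: best_position_pos)
  next
    note thresholds = thresholds_low_iff[OF F mono \<beta> q cont c] m_unique
    assume "r < r0"
    then have "m < c" using less_iff by simp
    then show "thresholds_low G \<beta> q \<mu>0 r0 r xl xu"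
      using low m by (simp add: thresholds)
    fix xl' xu'
    assume "thresholds_low G \<beta> q \<mu>0 r0 r xl' xu'"
    then show "xl' = xl" "xu' = xu"
      using low \<open>m < c\<close> by (auto simp: thresholds)
  next
    note thresholds = thresholds_high_iff[OF F mono \<beta> q cont c] m_unique
    assume "r0 < r"
    then have "c < m" using less_iff by simp
    then show "thresholds_high G \<beta> q \<mu>0 r0 r xl xu"
      using high m by (simp add: thresholds)
    fix xl' xu'
    assume "thresholds_high G \<beta> q \<mu>0 r0 r xl' xu'"
    then show "xl' = xl" "xu' = xu"
      using high \<open>c < m\<close> by (auto simp: thresholds)
  qed
qed

end
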